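(* Let $p\ge1$ be an integer, $N=p+1\ge2$, and let $x_1,\dots,x_N\in[-1,1]$ be distinct nodes of a 1D reference element, with $\boldsymbol{x}=[x_1,\dots,x_N]^{\mathrm{T}}$. Let $\mathsf{A}_{\mathsf{D}}\in\mathbb{R}^{N\times N}$ be a symmetric matrix (volume dissipation operator) such that $$\mathsf{A}_{\mathsf{D}}\boldsymbol{x}^k=\boldsymbol{0}\quad\text{for all } k\in\{0,1,\dots,p-1\}.$$ Then $\mathsf{A}_{\mathsf{D}}$ is uniquely defined up to a multiplicative constant; that is, there is a matrix $\mathsf{M}\in\mathbb{R}^{N\times N}$ depending only on the nodes such that every symmetric $\mathsf{A}_{\mathsf{D}}\in\mathbb{R}^{N\times N}$ satisfying $\mathsf{A}_{\mathsf{D}}\boldsymbol{x}^k=\boldsymbol{0}$ for all $k\in\{0,1,\dots,p-1\}$ is of the form $\mathsf{A}_{\mathsf{D}}=\lambda\mathsf{M}$ for some $\lambda\in\mathbb{R}$.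
   Context: Powers of vectors are taken entrywise: $\boldsymbol{x}^k=[x_1^k,\dots,x_N^k]^{\mathrm{T}}$, with $\boldsymbol{x}^0=\boldsymbol{1}=[1,\dots,1]^{\mathrm{T}}$. *)

theory Defs
  imports "HOL-Analysis.Analysis"
begin

definition vec_power :: "real ^ 'n \<Rightarrow> nat \<Rightarrow> real ^ 'n" where
  "vec_power x k = (\<chi> i. (x $ i) ^ k)"

end

theory Submission
  imports Defs "HOL-Computational_Algebra.Polynomial"
begin

text \<open>
  Each row of \<open>A\<close> is a vector \<open>v\<close> that annihilates the powers \<open>x\<^sup>k\<close> with \<open>k < p\<close>, hence
  annihilates the nodal values of every polynomial of degree below \<open>p\<close>. With \<open>p + 1\<close> distinct
  nodes, such a vector is a multiple of the divided-difference functional of order \<open>p\<close>, whose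
  \<open>j\<close>-th coefficient is the reciprocal of the nodal product \<open>P\<^sub>j = (\<Prod>i\<noteq>j. x\<^sub>j - x\<^sub>i)\<close>. To see this,
  test \<open>v\<close> against the polynomial of degree \<open>p - 1\<close> that vanishes at all nodes except the two with
  indices \<open>j\<close> and \<open>k\<close>: the outcome is \<open>v\<^sub>j P\<^sub>j = v\<^sub>k P\<^sub>k\<close> (\<open>annihilator_nodal_product_eq\<close>).

  So \<open>A\<^sub>i\<^sub>j P\<^sub>j\<close> does not depend on \<open>j\<close>, and by symmetry \<open>A\<^sub>i\<^sub>j P\<^sub>i\<close> does not depend on \<open>i\<close>.
  Hence \<open>A\<^sub>i\<^sub>j P\<^sub>i P\<^sub>j\<close> is a single constant \<open>c\<close>, and \<open>A = c M\<close> for the matrix \<open>M\<close> with entries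
  \<open>1 / (P\<^sub>i P\<^sub>j)\<close>.
\<close>

definition nodal_product :: "real ^ 'n \<Rightarrow> 'n \<Rightarrow> real" where
  "nodal_product x j = (\<Prod>i\<in>UNIV - {j}. x $ j - x $ i)"

lemma nodal_product_nonzero:
  assumes "inj (\<lambda>i. x $ i)"
  shows "nodal_product x j \<noteq> 0"
  using assms by (auto simp: nodal_product_def dest: injD)

lemma annihilator_of_powers_annihilates_polynomials:
  fixes v x :: "real ^ 'n" and q :: "real poly"
  assumes powers: "\<And>k. k < n \<Longrightarrow> (\<Sum>i\<in>UNIV. v $ i * x $ i ^ k) = 0"
    and "degree q < n"
  shows "(\<Sum>i\<in>UNIV. v $ i * poly q (x $ i)) = 0"
proof -
  have "(\<Sum>i\<in>UNIV. v $ i * poly q (x $ i)) =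
      (\<Sum>k\<le>degree q. coeff q k * (\<Sum>i\<in>UNIV. v $ i * x $ i ^ k))"
    unfolding poly_altdef sum_distrib_left
    by (subst sum.swap) (simp add: mult_ac)
  also have "\<dots> = 0"
    using assms by (intro sum.neutral) auto
  finally show ?thesis .
qed

text \<open>
  The test polynomial is the product of \<open>X - x\<^sub>i\<close> over all \<open>i\<close> other than \<open>j\<close> and \<open>k\<close>. Its values at
  the two remaining nodes are \<open>P\<^sub>j / (x\<^sub>j - x\<^sub>k)\<close> and \<open>P\<^sub>k / (x\<^sub>k - x\<^sub>j)\<close>, with opposite denominators;
  this is why the two weighted entries come out equal.
\<close>

lemma annihilator_nodal_product_eq:
  fixes v x :: "real ^ 'n"
  assumes powers: "\<And>k. k < p \<Longrightarrow> (\<Sum>i\<in>UNIV. v $ i * x $ i ^ k) = 0"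
    and card: "CARD('n) = p + 1"
    and inj: "inj (\<lambda>i. x $ i)"
  shows "v $ j * nodal_product x j = v $ k * nodal_product x k"
proof (cases "j = k")
  case False
  define S where "S = UNIV - {j, k}"
  define q where "q = (\<Prod>i\<in>S. [:- x $ i, 1:])"
  have q_eval: "poly q t = (\<Prod>i\<in>S. t - x $ i)" for t
    by (simp add: q_def poly_prod)
  have "card S + 2 = p + 1"
    using False card card_mono[of UNIV "{j, k}"] by (simp add: S_def card_Diff_subset)
  moreover have "degree q = card S"
    by (simp add: q_def degree_prod_eq_sum_degree)
  ultimately have "degree q < p"
    by simp
  then have "(\<Sum>i\<in>UNIV. v $ i * poly q (x $ i)) = 0"
    using powers by (intro annihilator_of_powers_annihilates_polynomials)
  moreover have "(\<Sum>i\<in>UNIV. v $ i * poly q (x $ i)) = (\<Sum>i\<in>{j, k}. v $ i * poly q (x $ i))"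
    by (intro sum.mono_neutral_right) (auto simp: q_eval S_def)
  ultimately have balance: "v $ j * poly q (x $ j) = - (v $ k * poly q (x $ k))"
    using False by simp
  have "UNIV - {j} = insert k S" "UNIV - {k} = insert j S"
    using False by (auto simp: S_def)
  then have "nodal_product x j = (x $ j - x $ k) * poly q (x $ j)"
    and "nodal_product x k = (x $ k - x $ j) * poly q (x $ k)"
    by (simp_all add: nodal_product_def q_eval S_def)
  then have "v $ j * nodal_product x j = (x $ j - x $ k) * (v $ j * poly q (x $ j))"
    and "v $ k * nodal_product x k = (x $ k - x $ j) * (v $ k * poly q (x $ k))"
    by simp_all
  with balance show ?thesis
    by (simp add: left_diff_distrib)
qed simp

theorem theorem6:
  fixes p :: nat and x :: "real ^ 'n"
  assumes "p \<ge> 1"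
    and "CARD('n) = p + 1"
    and "\<And>i. x $ i \<in> {-1..1}"
    and "inj (\<lambda>i. x $ i)"
  shows "\<exists>M :: real ^ 'n ^ 'n. \<forall>A :: real ^ 'n ^ 'n.
           transpose A = A \<and> (\<forall>k \<in> {0..p - 1}. A *v vec_power x k = 0)
           \<longrightarrow> (\<exists>c :: real. A = c *\<^sub>R M)"
proof (intro exI[of _ "\<chi> i j. 1 / (nodal_product x i * nodal_product x j)"] allI impI)
  fix A :: "real ^ 'n ^ 'n"
  assume A: "transpose A = A \<and> (\<forall>k \<in> {0..p - 1}. A *v vec_power x k = 0)"
  let ?P = "nodal_product x"
  have sym: "A $ i $ j = A $ j $ i" for i j
    using A by (metis transpose_def vec_lambda_beta)
  have powers: "(\<Sum>j\<in>UNIV. A $ i $ j * x $ j ^ k) = 0" if "k < p" for i k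
  proof -
    have "(A *v vec_power x k) $ i = 0"
      using A that by simp
    then show ?thesis
      by (simp add: matrix_vector_mult_def vec_power_def)
  qed
  have row: "A $ i $ j * ?P j = A $ i $ k * ?P k" for i j k
    using powers assms by (intro annihilator_nodal_product_eq)
  \<comment> \<open>Any diagonal entry can provide the constant, so the reference index is arbitrary.\<close>
  fix r :: 'n
  define c where "c = A $ r $ r * ?P r * ?P r"
  have "A $ i $ j * ?P i * ?P j = c" for i j
  proof -
    have "A $ i $ j * ?P i * ?P j = (A $ i $ j * ?P j) * ?P i"
      by simp
    also have "\<dots> = (A $ r $ i * ?P i) * ?P r"
      using row[of i j r] sym[of i r] by simp
    also have "\<dots> = c"
      using row[of r i r] by (simp add: c_def)
    finally show ?thesis .
  qed
  then have "A = c *\<^sub>R (\<chi> i j. 1 / (?P i * ?P j))"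
    using nodal_product_nonzero[OF assms(4)] by (simp add: vec_eq_iff field_simps)
  then show "\<exists>c. A = c *\<^sub>R (\<chi> i j. 1 / (?P i * ?P j))" ..
qed

end
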